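(* Let $G$ be an eulerian graph and let $k$ be a positive integer with $k\equiv |E(G)|\pmod 2$. Then $G$ admits a $k$-odd decomposition if and only if $G$ contains at least $k$ pairwise edge-disjoint circuits of odd length.
   Context: Graphs are finite and may have multiple edges and loops. A graph is eulerian if it is connected and every vertex has even degree. A decomposition of a graph $G$ is a set $\{G_1,\dots,G_k\}$ of subgraphs of $G$ whose edge sets partition $E(G)$. A decomposition $\{G_1,\dots,G_k\}$ is $k$-odd if each $G_i$ is an eulerian subgraph (a closed trail) with an odd number of edges. A circuit is a closed trail whose inner vertices are distinct (loops count as circuits of length $1$). *)

theory Defs
  imports "HOL-Library.Uprod" "HOL-Library.Disjoint_Sets"
begin

text \<open>
  Undirected multigraphs: edges have their own identity, so parallel edges are distinct elements of
  \<open>edges G\<close> with the same \<open>ends\<close>; an edge with \<open>ends G e = Upair v v\<close> is a loop at \<open>v\<close>.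
\<close>

record ('v, 'e) mgraph =
  verts :: "'v set"
  edges :: "'e set"
  ends :: "'e \<Rightarrow> 'v uprod"

definition finite_mgraph :: "('v, 'e) mgraph \<Rightarrow> bool" where
  "finite_mgraph G \<longleftrightarrow>
     finite (verts G) \<and> finite (edges G) \<and> (\<forall>e\<in>edges G. set_uprod (ends G e) \<subseteq> verts G)"

text \<open>Every loop at \<open>v\<close> is counted in both summands, hence contributes 2 to the degree.\<close>

definition degree :: "('v, 'e) mgraph \<Rightarrow> 'v \<Rightarrow> nat" where
  "degree G v =
     card {e \<in> edges G. v \<in> set_uprod (ends G e)} + card {e \<in> edges G. ends G e = Upair v v}"

text \<open>
  A walk \<open>v\<^sub>0 e\<^sub>1 v\<^sub>1 \<dots> e\<^sub>n v\<^sub>n\<close> is given by its vertex list \<open>[v\<^sub>0, \<dots>, v\<^sub>n]\<close> and its edge list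
  \<open>[e\<^sub>1, \<dots>, e\<^sub>n]\<close>; its length is the length of the edge list.
\<close>

definition walk :: "('v, 'e) mgraph \<Rightarrow> 'v list \<Rightarrow> 'e list \<Rightarrow> bool" where
  "walk G vs es \<longleftrightarrow>
     length vs = Suc (length es) \<and> set vs \<subseteq> verts G \<and> set es \<subseteq> edges G \<and>
     (\<forall>i<length es. ends G (es ! i) = Upair (vs ! i) (vs ! Suc i))"

definition closed_trail :: "('v, 'e) mgraph \<Rightarrow> 'v list \<Rightarrow> 'e list \<Rightarrow> bool" where
  "closed_trail G vs es \<longleftrightarrow> walk G vs es \<and> distinct es \<and> hd vs = last vs"

text \<open>
  In a circuit \<open>v\<^sub>0 e\<^sub>1 v\<^sub>1 \<dots> e\<^sub>n v\<^sub>n = v\<^sub>0\<close> the inner vertices are distinct from one another and from the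
  common end vertex, i.e. \<open>v\<^sub>1, \<dots>, v\<^sub>n\<close> are distinct. The trivial closed trail is not a circuit.
\<close>

definition circuit :: "('v, 'e) mgraph \<Rightarrow> 'v list \<Rightarrow> 'e list \<Rightarrow> bool" where
  "circuit G vs es \<longleftrightarrow> closed_trail G vs es \<and> es \<noteq> [] \<and> distinct (tl vs)"

text \<open>Connected graphs are nonempty.\<close>

definition connected_mgraph :: "('v, 'e) mgraph \<Rightarrow> bool" where
  "connected_mgraph G \<longleftrightarrow> verts G \<noteq> {} \<and>
     (\<forall>u\<in>verts G. \<forall>v\<in>verts G. \<exists>vs es. walk G vs es \<and> hd vs = u \<and> last vs = v)"

definition eulerian :: "('v, 'e) mgraph \<Rightarrow> bool" where
  "eulerian G \<longleftrightarrow> connected_mgraph G \<and> (\<forall>v\<in>verts G. even (degree G v))"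

definition subgraph :: "('v, 'e) mgraph \<Rightarrow> ('v, 'e) mgraph \<Rightarrow> bool" where
  "subgraph H G \<longleftrightarrow> finite_mgraph H \<and> verts H \<subseteq> verts G \<and> edges H \<subseteq> edges G \<and>
     (\<forall>e\<in>edges H. ends H e = ends G e)"

text \<open>
  Injectivity of \<open>edges\<close> on \<open>D\<close> makes different members of \<open>D\<close> different blocks of the partition
  (\<open>partition_on\<close> alone only speaks about the set of edge sets).
\<close>

definition decomposition :: "('v, 'e) mgraph \<Rightarrow> ('v, 'e) mgraph set \<Rightarrow> bool" where
  "decomposition G D \<longleftrightarrow>
     (\<forall>H\<in>D. subgraph H G) \<and> inj_on edges D \<and> partition_on (edges G) (edges ` D)"

definition odd_decomposition :: "nat \<Rightarrow> ('v, 'e) mgraph \<Rightarrow> ('v, 'e) mgraph set \<Rightarrow> bool" where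
  "odd_decomposition k G D \<longleftrightarrow> decomposition G D \<and> finite D \<and> card D = k \<and>
     (\<forall>H\<in>D. eulerian H \<and> odd (card (edges H)))"

end

theory Submission
  imports Defs
begin

text \<open>
  Peeling off circuits splits \<open>G\<close> into circuits that include the given \<open>k\<close> odd ones. Two parts
  that share a vertex can be merged into one eulerian part. Merging an even part with a neighbour
  keeps the number of odd parts; once all parts are odd, merging two neighbours lowers it by 2.
  By parity, repeated merging ends with exactly \<open>k\<close> odd parts and no even one. Conversely, every
  even subgraph with an odd number of edges contains an odd circuit, again by peeling off circuits.
\<close>

section \<open>Walks\<close>

lemma walk_Nil [simp]: "walk G vs [] \<longleftrightarrow> (\<exists>v\<in>verts G. vs = [v])"
  unfolding walk_def by (cases vs) auto

text \<open>The indexed definition turned into a recursion that splits off the first edge; the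
  inductions over walks rest on it.\<close>

lemma walk_Cons:
  "walk G vs (e # es) \<longleftrightarrow> (\<exists>u w ws. vs = u # w # ws \<and> u \<in> verts G \<and> e \<in> edges G \<and>
     ends G e = Upair u w \<and> walk G (w # ws) es)"
proof -
  have "walk G (u # w # ws) (e # es) \<longleftrightarrow> u \<in> verts G \<and> e \<in> edges G \<and>
     ends G e = Upair u w \<and> walk G (w # ws) es" for u w ws
    unfolding walk_def by (auto simp: All_less_Suc2)
  moreover have "\<exists>u w ws. vs = u # w # ws" if "walk G vs (e # es)"
    using that unfolding walk_def by (metis length_Suc_conv)
  ultimately show ?thesis by blast
qed

lemma walk_take:
  assumes "walk G vs es" "i \<le> length es"
  shows "walk G (take (Suc i) vs) (take i es)"
  using assms set_take_subset[of "Suc i" vs] set_take_subset[of i es]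
  unfolding walk_def by auto

lemma walk_ends_subset: "walk G vs es \<Longrightarrow> e \<in> set es \<Longrightarrow> set_uprod (ends G e) \<subseteq> set vs"
  by (induction es arbitrary: vs) (fastforce simp: walk_Cons)+

section \<open>Even and connected edge sets\<close>

text \<open>The share of one edge in the degree of \<open>v\<close>, 2 for a loop. Degrees become
  sums that split over disjoint edge sets, and with only the end map \<open>f\<close> as parameter
  no graph has to be built for each edge set.\<close>

definition incidence :: "('e \<Rightarrow> 'v uprod) \<Rightarrow> 'v \<Rightarrow> 'e \<Rightarrow> nat" where
  "incidence f v e = of_bool (v \<in> set_uprod (f e)) + of_bool (f e = Upair v v)"

text \<open>Quantifying over the whole type avoids carrying a vertex set along: a vertex that meets
  no edge of \<open>F\<close> has sum 0.\<close>

definition even_edge_set :: "('e \<Rightarrow> 'v uprod) \<Rightarrow> 'e set \<Rightarrow> bool" where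
  "even_edge_set f F \<longleftrightarrow> (\<forall>v. even (\<Sum>e\<in>F. incidence f v e))"

definition vertices_of :: "('e \<Rightarrow> 'v uprod) \<Rightarrow> 'e set \<Rightarrow> 'v set" where
  "vertices_of f F = (\<Union>e\<in>F. set_uprod (f e))"

definition adjacency :: "('e \<Rightarrow> 'v uprod) \<Rightarrow> 'e set \<Rightarrow> 'v rel" where
  "adjacency f F = {(u, v). \<exists>e\<in>F. f e = Upair u v}"

text \<open>Only vertices met by \<open>F\<close> are compared, so isolated vertices cannot destroy
  connectedness, and the empty set counts as connected.\<close>

definition connected_edge_set :: "('e \<Rightarrow> 'v uprod) \<Rightarrow> 'e set \<Rightarrow> bool" where
  "connected_edge_set f F \<longleftrightarrow>
     (\<forall>u\<in>vertices_of f F. \<forall>v\<in>vertices_of f F. (u, v) \<in> (adjacency f F)\<^sup>*)"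

lemma vertices_of_eq_empty_iff: "vertices_of f F = {} \<longleftrightarrow> F = {}"
proof -
  have "set_uprod (f e) \<noteq> {}" for e
    by (cases "f e") simp
  then show ?thesis by (auto simp: vertices_of_def)
qed

lemma mem_set_uprod_imp_Upair:
  assumes "v \<in> set_uprod p"
  obtains w where "p = Upair v w"
proof (cases p)
  case (Upair a b)
  then show ?thesis using assms that[of a] that[of b] by auto
qed

lemma incidence_Upair:
  "f e = Upair a b \<Longrightarrow> incidence f v e = of_bool (v = a) + of_bool (v = b)"
  unfolding incidence_def by auto

lemma incidence_eq_0: "v \<notin> set_uprod (f e) \<Longrightarrow> incidence f v e = 0"
  unfolding incidence_def by auto

lemma incidence_cong: "f e = g e \<Longrightarrow> incidence f v e = incidence g v e"
  unfolding incidence_def by simp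

section \<open>Parity of degrees\<close>

lemma degree_eq_sum_incidence:
  assumes "finite (edges G)"
  shows "degree G v = (\<Sum>e\<in>edges G. incidence (ends G) v e)"
proof -
  have "edges G \<inter> {e. P e} = {e \<in> edges G. P e}" for P by blast
  then show ?thesis
    unfolding degree_def incidence_def using assms
    by (simp add: sum.distrib sum_of_bool_eq)
qed

lemma eulerian_even_edge_set:
  assumes "finite_mgraph G" "eulerian G"
  shows "even_edge_set (ends G) (edges G)"
  unfolding even_edge_set_def
proof
  fix v
  show "even (\<Sum>e\<in>edges G. incidence (ends G) v e)"
  proof (cases "v \<in> verts G")
    case True
    then show ?thesis
      using assms by (simp add: eulerian_def finite_mgraph_def flip: degree_eq_sum_incidence)
  next
    case False
    then have "(\<Sum>e\<in>edges G. incidence (ends G) v e) = 0"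
      using assms by (intro sum.neutral) (auto simp: finite_mgraph_def intro!: incidence_eq_0)
    then show ?thesis by simp
  qed
qed

lemma even_edge_set_Un:
  assumes "even_edge_set f A" "even_edge_set f B" "finite A" "finite B" "A \<inter> B = {}"
  shows "even_edge_set f (A \<union> B)"
  using assms unfolding even_edge_set_def by (simp add: sum.union_disjoint)

lemma even_edge_set_Diff:
  assumes "even_edge_set f A" "even_edge_set f B" "finite A" "B \<subseteq> A"
  shows "even_edge_set f (A - B)"
  unfolding even_edge_set_def
proof
  fix v
  have "(\<Sum>e\<in>A. incidence f v e) = (\<Sum>e\<in>A - B. incidence f v e) + (\<Sum>e\<in>B. incidence f v e)"
    using assms(3,4) by (simp add: sum.subset_diff)
  then show "even (\<Sum>e\<in>A - B. incidence f v e)"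
    using assms(1,2) unfolding even_edge_set_def by (metis even_add)
qed

text \<open>Each passage of a trail through a vertex uses two edge ends, so only the first and last
  vertex can be odd, and they cancel if they coincide. In the induction the first edge flips the
  parity at its two ends.\<close>

lemma odd_incidence_trail_iff:
  assumes "walk G vs es" "distinct es"
  shows "odd (\<Sum>e\<in>set es. incidence (ends G) v e) \<longleftrightarrow> (v = hd vs) \<noteq> (v = last vs)"
  using assms
proof (induction es arbitrary: vs)
  case Nil
  then show ?case by auto
next
  case (Cons e es)
  then obtain u w ws where vs: "vs = u # w # ws" "ends G e = Upair u w" "walk G (w # ws) es"
    by (auto simp: walk_Cons)
  have "odd (\<Sum>e\<in>set es. incidence (ends G) v e) \<longleftrightarrow> (v = w) \<noteq> (v = last (w # ws))"
    using Cons.IH[OF vs(3)] Cons.prems(2) by simp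
  moreover have "incidence (ends G) v e = of_bool (v = u) + of_bool (v = w)"
    using vs(2) by (rule incidence_Upair)
  ultimately show ?case
    using Cons.prems(2) vs(1) by auto
qed

section \<open>Reachability and connectedness\<close>

lemma sym_adjacency: "sym (adjacency f F)"
proof (rule symI)
  fix u v
  assume "(u, v) \<in> adjacency f F"
  moreover have "Upair u v = Upair v u" by simp
  ultimately show "(v, u) \<in> adjacency f F"
    by (simp add: adjacency_def)
qed

lemma adjacency_mono: "A \<subseteq> B \<Longrightarrow> adjacency f A \<subseteq> adjacency f B"
  unfolding adjacency_def by blast

text \<open>The relation uses only edges of the walk itself; this is what makes the edge set of a
  walk connected on its own.\<close>

lemma walk_imp_reachable:
  "walk G vs es \<Longrightarrow> x \<in> set vs \<Longrightarrow> (hd vs, x) \<in> (adjacency (ends G) (set es))\<^sup>*"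
proof (induction es arbitrary: vs)
  case Nil
  then show ?case by auto
next
  case (Cons e es)
  then obtain u w ws where vs: "vs = u # w # ws" "ends G e = Upair u w" "walk G (w # ws) es"
    by (auto simp: walk_Cons)
  show ?case
  proof (cases "x = u")
    case False
    then have "(w, x) \<in> (adjacency (ends G) (set es))\<^sup>*"
      using Cons.IH[OF vs(3)] Cons.prems(2) vs(1) by auto
    then have "(w, x) \<in> (adjacency (ends G) (set (e # es)))\<^sup>*"
      using rtrancl_mono[OF adjacency_mono] by (metis set_subset_Cons subsetD)
    moreover have "(u, w) \<in> adjacency (ends G) (set (e # es))"
      using vs(2) by (auto simp: adjacency_def)
    ultimately show ?thesis
      using vs(1) by (simp add: converse_rtrancl_into_rtrancl)
  qed (use vs in auto)
qed

lemma reachable_imp_walk: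
  assumes "finite_mgraph G" "v \<in> verts G" "(u, v) \<in> (adjacency (ends G) (edges G))\<^sup>*"
  shows "\<exists>vs es. walk G vs es \<and> hd vs = u \<and> last vs = v"
  using assms(3)
proof (induction rule: converse_rtrancl_induct)
  case base
  have "walk G [v] []" using assms(2) by simp
  then show ?case by (metis last.simps list.sel(1))
next
  case (step x y)
  then obtain vs es e where w: "walk G vs es" "hd vs = y" "last vs = v"
    and e: "e \<in> edges G" "ends G e = Upair x y"
    by (auto simp: adjacency_def)
  obtain ws where vs: "vs = y # ws"
    using w by (cases vs) (auto simp: walk_def)
  have "x \<in> verts G"
    using assms(1) e by (fastforce simp: finite_mgraph_def)
  then have "walk G (x # vs) (e # es)"
    using w e vs by (simp add: walk_Cons)
  then show ?case
    using w(3) vs by (metis last_ConsR list.distinct(1) list.sel(1))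
qed

lemma closed_trail_even_edge_set:
  "closed_trail G vs es \<Longrightarrow> even_edge_set (ends G) (set es)"
  unfolding closed_trail_def even_edge_set_def using odd_incidence_trail_iff by metis

lemma walk_connected_edge_set:
  assumes "walk G vs es"
  shows "connected_edge_set (ends G) (set es)"
  unfolding connected_edge_set_def
proof (intro ballI)
  fix u v
  assume "u \<in> vertices_of (ends G) (set es)" "v \<in> vertices_of (ends G) (set es)"
  then have "u \<in> set vs" "v \<in> set vs"
    using walk_ends_subset[OF assms] by (auto simp: vertices_of_def)
  then have "(hd vs, u) \<in> (adjacency (ends G) (set es))\<^sup>*" "(hd vs, v) \<in> (adjacency (ends G) (set es))\<^sup>*"
    using walk_imp_reachable[OF assms] by auto
  then show "(u, v) \<in> (adjacency (ends G) (set es))\<^sup>*"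
    by (meson rtrancl_trans symD sym_rtrancl sym_adjacency)
qed

text \<open>A common vertex \<open>x\<close> reaches every vertex of both sets, and reachability is
  symmetric.\<close>

lemma connected_edge_set_Un:
  assumes "connected_edge_set f A" "connected_edge_set f B" "vertices_of f A \<inter> vertices_of f B \<noteq> {}"
  shows "connected_edge_set f (A \<union> B)"
proof -
  let ?R = "(adjacency f (A \<union> B))\<^sup>*"
  obtain x where x: "x \<in> vertices_of f A" "x \<in> vertices_of f B"
    using assms(3) by blast
  have "(adjacency f A)\<^sup>* \<subseteq> ?R" "(adjacency f B)\<^sup>* \<subseteq> ?R"
    by (simp_all add: adjacency_mono rtrancl_mono)
  then have *: "(x, u) \<in> ?R" if "u \<in> vertices_of f (A \<union> B)" for u
    using that x assms(1,2) unfolding connected_edge_set_def vertices_of_def by blast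
  then show ?thesis
    unfolding connected_edge_set_def by (meson rtrancl_trans symD sym_rtrancl sym_adjacency)
qed

text \<open>If the vertex sets were disjoint, every edge of \<open>E\<close> at a vertex of
  \<open>A\<close> would belong to \<open>A\<close>. Reachability could then never leave the
  vertices of \<open>A\<close>, against connectedness of \<open>E\<close>.\<close>

lemma connected_edge_set_meets_complement:
  assumes "connected_edge_set f E" "A \<subseteq> E" "A \<noteq> {}" "E - A \<noteq> {}"
  shows "vertices_of f A \<inter> vertices_of f (E - A) \<noteq> {}"
proof
  assume disj: "vertices_of f A \<inter> vertices_of f (E - A) = {}"
  have "vertices_of f A \<noteq> {}" "vertices_of f (E - A) \<noteq> {}"
    unfolding vertices_of_eq_empty_iff by fact+
  then obtain a b where a: "a \<in> vertices_of f A" and b: "b \<in> vertices_of f (E - A)"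
    by blast
  have "(a, b) \<in> (adjacency f E)\<^sup>*"
    using assms(1,2) a b unfolding connected_edge_set_def vertices_of_def by blast
  then have "b \<in> vertices_of f A"
  proof (induction rule: rtrancl_induct)
    case (step x y)
    then obtain e where "e \<in> E" "f e = Upair x y" by (auto simp: adjacency_def)
    with step.IH disj show ?case
      by (cases "e \<in> A") (force simp: vertices_of_def)+
  qed (use a in simp)
  with b disj show False by blast
qed

lemma eulerian_connected_edge_set:
  assumes "finite_mgraph G" "eulerian G"
  shows "connected_edge_set (ends G) (edges G)"
  unfolding connected_edge_set_def
proof (intro ballI)
  fix u v
  assume "u \<in> vertices_of (ends G) (edges G)" "v \<in> vertices_of (ends G) (edges G)"
  then have "u \<in> verts G" "v \<in> verts G"
    using assms(1) by (auto simp: vertices_of_def finite_mgraph_def)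
  then obtain vs es where w: "walk G vs es" "hd vs = u" "last vs = v"
    using assms(2) unfolding eulerian_def connected_mgraph_def by blast
  then have "v \<in> set vs" by (metis last_in_set length_0_conv nat.distinct(1) walk_def)
  moreover have "set es \<subseteq> edges G" using w(1) by (simp add: walk_def)
  ultimately show "(u, v) \<in> (adjacency (ends G) (edges G))\<^sup>*"
    using walk_imp_reachable[OF w(1)] w(2) rtrancl_mono[OF adjacency_mono] by blast
qed

section \<open>Eulerian edge sets and the subgraphs they span\<close>

definition eulerian_edge_set :: "('e \<Rightarrow> 'v uprod) \<Rightarrow> 'e set \<Rightarrow> bool" where
  "eulerian_edge_set f A \<longleftrightarrow> A \<noteq> {} \<and> even_edge_set f A \<and> connected_edge_set f A"

text \<open>Taking just the ends of edges in \<open>A\<close> as vertices leaves no isolated vertex,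
  so connectedness of \<open>A\<close> carries over to the subgraph.\<close>

definition spanned_subgraph :: "('v, 'e) mgraph \<Rightarrow> 'e set \<Rightarrow> ('v, 'e) mgraph" where
  "spanned_subgraph G A = \<lparr>verts = vertices_of (ends G) A, edges = A, ends = ends G\<rparr>"

lemma spanned_subgraph_simps [simp]:
  "verts (spanned_subgraph G A) = vertices_of (ends G) A"
  "edges (spanned_subgraph G A) = A"
  "ends (spanned_subgraph G A) = ends G"
  by (simp_all add: spanned_subgraph_def)

lemma subgraph_spanned_subgraph:
  assumes "finite_mgraph G" "A \<subseteq> edges G"
  shows "subgraph (spanned_subgraph G A) G"
proof -
  have "vertices_of (ends G) A \<subseteq> verts G"
    using assms unfolding vertices_of_def finite_mgraph_def by blast
  moreover have "finite A" "finite (vertices_of (ends G) A)"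
    using assms calculation by (auto simp: finite_mgraph_def intro: finite_subset)
  ultimately show ?thesis
    using assms unfolding subgraph_def finite_mgraph_def by (auto simp: vertices_of_def)
qed

lemma eulerian_spanned_subgraph:
  assumes "finite_mgraph G" "A \<subseteq> edges G" "eulerian_edge_set (ends G) A"
  shows "eulerian (spanned_subgraph G A)"
proof -
  let ?H = "spanned_subgraph G A"
  have fin: "finite_mgraph ?H"
    using subgraph_spanned_subgraph[OF assms(1,2)] by (simp add: subgraph_def)
  have "vertices_of (ends G) A \<noteq> {}"
    using assms(3) by (simp add: eulerian_edge_set_def vertices_of_eq_empty_iff)
  moreover have "\<exists>vs es. walk ?H vs es \<and> hd vs = u \<and> last vs = v"
    if "u \<in> verts ?H" "v \<in> verts ?H" for u v
    using reachable_imp_walk[OF fin that(2)] that assms(3)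
    by (simp add: eulerian_edge_set_def connected_edge_set_def)
  ultimately have "connected_mgraph ?H"
    by (simp add: connected_mgraph_def)
  moreover have "even (degree ?H v)" for v
    using fin assms(3) degree_eq_sum_incidence[of ?H v]
    by (simp add: finite_mgraph_def eulerian_edge_set_def even_edge_set_def)
  ultimately show ?thesis by (simp add: eulerian_def)
qed

section \<open>Circuits in even edge sets\<close>

lemma path_extends_to_circuit:
  assumes "finite_mgraph G" "F \<subseteq> edges G" "even_edge_set (ends G) F"
    and "walk G vs es" "distinct vs" "distinct es" "set es \<subseteq> F" "hd vs \<in> vertices_of (ends G) F"
  shows "\<exists>vs es. circuit G vs es \<and> set es \<subseteq> F"
  using assms(4-)
proof (induction "card (verts G) - length vs" arbitrary: vs es rule: less_induct)
  case less
  have finF: "finite F" using assms(1,2) by (auto simp: finite_mgraph_def intro: finite_subset)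
  obtain a vs' where vs: "vs = a # vs'"
    using less.prems(1) by (cases vs) (auto simp: walk_def)
  have "\<exists>e\<in>F. a \<in> set_uprod (ends G e) \<and> e \<notin> set es"
  proof (cases es)
    case Nil
    then show ?thesis using less.prems(5) vs by (auto simp: vertices_of_def)
  next
    case (Cons e1 es')
    then obtain b ws where b: "vs' = b # ws" "ends G e1 = Upair a b" "walk G vs' es'"
      using less.prems(1) vs by (auto simp: walk_Cons)
    have "a \<noteq> b" using less.prems(2) vs b by auto
    \<comment> \<open>Since \<open>e1\<close> is no loop it contributes exactly 1 to an even sum, so
      some other edge of \<open>F\<close> meets \<open>a\<close>.\<close>
    then have "incidence (ends G) a e1 = 1" using incidence_Upair[of "ends G", OF b(2)] by simp
    moreover have "e1 \<in> F" using less.prems(4) Cons by auto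
    moreover have "even (\<Sum>e\<in>F. incidence (ends G) a e)"
      using assms(3) by (simp add: even_edge_set_def)
    ultimately have "(\<Sum>e\<in>F - {e1}. incidence (ends G) a e) \<noteq> 0"
      using sum.remove[OF finF, of e1 "incidence (ends G) a"] by (metis add.right_neutral odd_one)
    then obtain e where e: "e \<in> F - {e1}" "incidence (ends G) a e \<noteq> 0"
      by (meson sum.neutral)
    then have "a \<in> set_uprod (ends G e)" using incidence_eq_0 by metis
    \<comment> \<open>The remaining path avoids \<open>a\<close>, hence none of its edges meets
      \<open>a\<close>.\<close>
    moreover have "e \<notin> set es'"
      using walk_ends_subset[OF b(3)] calculation less.prems(2) vs by auto
    ultimately show ?thesis using e Cons by auto
  qed
  then obtain e w where e: "e \<in> F" "e \<notin> set es" "ends G e = Upair a w"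
    using mem_set_uprod_imp_Upair by metis
  have "w \<in> set_uprod (ends G e)" using e(3) by simp
  then have w: "w \<in> verts G" "w \<in> vertices_of (ends G) F"
    using e(1) assms(1,2) unfolding finite_mgraph_def vertices_of_def by blast+
  show ?case
  proof (cases "w \<in> set vs")
    case True
    then obtain i where i: "i < length vs" "vs ! i = w" by (auto simp: in_set_conv_nth)
    have len: "length vs = Suc (length es)" using less.prems(1) by (simp add: walk_def)
    \<comment> \<open>The circuit is the new edge followed by the path up to \<open>w\<close>. The
      case \<open>i = 0\<close> is a loop at \<open>a\<close>, giving a circuit of length 1.\<close>
    have "walk G (take (Suc i) vs) (take i es)"
      using walk_take[OF less.prems(1)] i len by simp
    then have "walk G (w # take (Suc i) vs) (e # take i es)"
      using e w vs assms(2) by (auto simp: walk_Cons insert_commute)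
    moreover have "last (take (Suc i) vs) = w"
      using i by (simp add: take_Suc_conv_app_nth)
    moreover have "take (Suc i) vs \<noteq> []" using vs by simp
    moreover have "distinct (e # take i es)" "set (e # take i es) \<subseteq> F"
      using less.prems(3,4) e set_take_subset[of i es] by auto
    ultimately have "circuit G (w # take (Suc i) vs) (e # take i es)"
      using less.prems(2) by (auto simp: circuit_def closed_trail_def)
    then show ?thesis using \<open>set (e # take i es) \<subseteq> F\<close> by blast
  next
    case False
    have d: "distinct (w # vs)" using False less.prems(2) by simp
    have "set (w # vs) \<subseteq> verts G" using less.prems(1) w by (auto simp: walk_def)
    \<comment> \<open>This bound keeps the truncated subtraction in the induction measure strictly
      decreasing.\<close>
    then have "length (w # vs) \<le> card (verts G)"
      using assms(1) distinct_card[OF d] by (metis card_mono finite_mgraph_def)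
    then have "card (verts G) - length (w # vs) < card (verts G) - length vs" by simp
    moreover have "walk G (w # vs) (e # es)"
      using e w vs less.prems(1) assms(2) by (auto simp: walk_Cons)
    ultimately show ?thesis
      using less.hyps[OF _ _ d, of "e # es"] e w less.prems by auto
  qed
qed

lemma even_edge_set_contains_circuit:
  assumes "finite_mgraph G" "F \<subseteq> edges G" "even_edge_set (ends G) F" "F \<noteq> {}"
  shows "\<exists>vs es. circuit G vs es \<and> set es \<subseteq> F"
proof -
  obtain e where "e \<in> F" using assms(4) by blast
  then obtain v where v: "v \<in> vertices_of (ends G) F" "v \<in> verts G"
    using assms(1,2) by (cases "ends G e") (fastforce simp: vertices_of_def finite_mgraph_def)
  then show ?thesis
    using path_extends_to_circuit[OF assms(1-3), of "[v]" "[]"] by simp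
qed

lemma circuit_eulerian_edge_set:
  "circuit G vs es \<Longrightarrow> eulerian_edge_set (ends G) (set es)"
  by (auto simp: circuit_def eulerian_edge_set_def closed_trail_even_edge_set closed_trail_def
      intro: walk_connected_edge_set)

text \<open>Removing a circuit of even length preserves both even degrees and the odd number of
  edges. The set shrinks each time but never becomes empty, so an odd circuit must turn up.\<close>

lemma odd_even_edge_set_contains_odd_circuit:
  assumes "finite_mgraph G" "F \<subseteq> edges G" "even_edge_set (ends G) F" "odd (card F)"
  shows "\<exists>vs es. circuit G vs es \<and> set es \<subseteq> F \<and> odd (length es)"
proof -
  have "finite F" using assms(1,2) by (auto simp: finite_mgraph_def intro: finite_subset)
  then show ?thesis
    using assms(2-)
  proof (induction rule: finite_psubset_induct)
    case (psubset F)
    then have "F \<noteq> {}" by auto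
    then obtain vs es where c: "circuit G vs es" "set es \<subseteq> F"
      using even_edge_set_contains_circuit[OF assms(1) psubset.prems(1,2)] by blast
    have ee: "even_edge_set (ends G) (set es)" "es \<noteq> []" and d: "card (set es) = length es"
      using c(1) closed_trail_even_edge_set
      by (auto simp: circuit_def closed_trail_def distinct_card)
    show ?case
    proof (cases "odd (length es)")
      case False
      have "card F = card (F - set es) + length es"
        using c(2) psubset.hyps d by (metis card_Diff_subset card_mono finite_set le_add_diff_inverse2)
      then have "odd (card (F - set es))" using False psubset.prems(3) by simp
      moreover have "F - set es \<subset> F" using c(2) ee(2) by (cases es) auto
      ultimately show ?thesis
        using psubset.IH[of "F - set es"] psubset.prems(1)
          even_edge_set_Diff[OF psubset.prems(2) ee(1) psubset.hyps c(2)] by blast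
    qed (use c in blast)
  qed
qed

text \<open>Circuits are removed one at a time, which keeps all degrees even, until nothing remains;
  their edge sets are the blocks.\<close>

lemma even_edge_set_partition:
  assumes "finite_mgraph G" "F \<subseteq> edges G" "even_edge_set (ends G) F"
  shows "\<exists>P. partition_on F P \<and> (\<forall>A\<in>P. eulerian_edge_set (ends G) A)"
proof -
  have "finite F" using assms(1,2) by (auto simp: finite_mgraph_def intro: finite_subset)
  then show ?thesis
    using assms(2-)
  proof (induction rule: finite_psubset_induct)
    case (psubset F)
    show ?case
    proof (cases "F = {}")
      case True
      then show ?thesis by (metis empty_iff partition_on_empty)
    next
      case False
      then obtain vs es where c: "circuit G vs es" "set es \<subseteq> F"
        using even_edge_set_contains_circuit[OF assms(1) psubset.prems] by blast
      note ee = circuit_eulerian_edge_set[OF c(1)]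
      then have ne: "set es \<noteq> {}" unfolding eulerian_edge_set_def by (rule conjunct1)
      have "F - set es \<subset> F" using c(2) ne by (cases es) auto
      moreover have "even_edge_set (ends G) (F - set es)"
        using even_edge_set_Diff psubset.prems(2) psubset.hyps c(2) ee
        by (auto simp: eulerian_edge_set_def)
      ultimately obtain P where P: "partition_on (F - set es) P"
        "\<forall>A\<in>P. eulerian_edge_set (ends G) A"
        using psubset.IH[of "F - set es"] psubset.prems(1) by blast
      have "partition_on (set es \<union> (F - set es)) (insert (set es) P)"
        using P(1) ee unfolding partition_on_def eulerian_edge_set_def
        by (auto simp: disjoint_def)
      then show ?thesis
        using P(2) ee c(2) by (metis Un_Diff_cancel insert_iff sup.absorb2)
    qed
  qed
qed

section \<open>Merging parts\<close>

lemma eulerian_edge_set_Un: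
  assumes "eulerian_edge_set f A" "eulerian_edge_set f B" "finite A" "finite B" "A \<inter> B = {}"
    and "vertices_of f A \<inter> vertices_of f B \<noteq> {}"
  shows "eulerian_edge_set f (A \<union> B)"
  using assms even_edge_set_Un[of f A B] connected_edge_set_Un[of f A B]
  by (simp add: eulerian_edge_set_def)

lemma merge_partition:
  assumes "partition_on E P" "A \<in> P" "B \<in> P" "A \<noteq> B"
  shows "partition_on E (insert (A \<union> B) (P - {A, B}))"
proof (rule partition_onI)
  have un: "\<Union>P = E" and ne: "{} \<notin> P" and dis: "\<And>C D. C \<in> P \<Longrightarrow> D \<in> P \<Longrightarrow> C \<noteq> D \<Longrightarrow> C \<inter> D = {}"
    using assms(1) by (auto simp: partition_on_def disjoint_def)
  show "\<Union>(insert (A \<union> B) (P - {A, B})) = E"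
    using un assms(2,3) by blast
  show "disjnt C D" if CD: "C \<in> insert (A \<union> B) (P - {A, B})" "D \<in> insert (A \<union> B) (P - {A, B})"
    "C \<noteq> D" for C D
  proof -
    have "disjnt (A \<union> B) X" if "X \<in> P - {A, B}" for X
      using that dis[of A X] dis[of B X] assms(2,3) by (auto simp: disjnt_def)
    then show ?thesis
      using CD dis[of C D] by (metis DiffD1 disjnt_def disjnt_sym insertE)
  qed
  show "{} \<notin> insert (A \<union> B) (P - {A, B})"
    using ne assms(2) by auto
qed

text \<open>By connectedness \<open>A\<close> shares a vertex with its nonempty complement; the
  block of a complementary edge at that vertex is the neighbour sought.\<close>

lemma exists_touching_part:
  assumes "partition_on E P" "connected_edge_set f E" "A \<in> P" "P \<noteq> {A}"
  shows "\<exists>B\<in>P. B \<noteq> A \<and> vertices_of f A \<inter> vertices_of f B \<noteq> {}"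
proof -
  have sub: "A \<subseteq> E" "A \<noteq> {}" using assms(1,3) by (auto simp: partition_on_def)
  obtain B where B: "B \<in> P" "B \<noteq> A" using assms(3,4) by blast
  then have "B \<inter> A = {}" "B \<noteq> {}" "B \<subseteq> E"
    using assms(1,3) disjointD[OF partition_onD2[OF assms(1)] B(1) assms(3)]
    by (auto simp: partition_on_def)
  then have "E - A \<noteq> {}" by auto
  then obtain x where x: "x \<in> vertices_of f A" "x \<in> vertices_of f (E - A)"
    using connected_edge_set_meets_complement[OF assms(2) sub] by blast
  then obtain e where e: "e \<in> E - A" "x \<in> set_uprod (f e)" by (auto simp: vertices_of_def)
  then obtain B where B: "B \<in> P" "e \<in> B" using assms(1) by (auto simp: partition_on_def)
  then have "B \<noteq> A" "x \<in> vertices_of f B" using e by (auto simp: vertices_of_def)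
  then show ?thesis using B x by blast
qed

text \<open>The sum of \<open>card A mod 2\<close> is the number of odd parts. It stays at least
  \<open>k\<close> while the induction on the number of parts merges touching pairs.\<close>

lemma merge_to_odd_parts:
  assumes "finite E" "connected_edge_set f E" "k > 0" "k mod 2 = card E mod 2"
    and "partition_on E P" "\<forall>A\<in>P. eulerian_edge_set f A" "(\<Sum>A\<in>P. card A mod 2) \<ge> k"
  shows "\<exists>Q. partition_on E Q \<and> (\<forall>A\<in>Q. eulerian_edge_set f A \<and> odd (card A)) \<and> card Q = k"
  using assms(5-)
proof (induction "card P" arbitrary: P rule: less_induct)
  case less
  let ?t = "\<lambda>P. \<Sum>A\<in>P. card A mod 2"
  have finP: "finite P" using less.prems(1) assms(1) by (metis finite_elements)
  have finA: "finite A" if "A \<in> P" for A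
    using that less.prems(1) assms(1) by (auto simp: partition_on_def intro: finite_subset)
  have "card E = (\<Sum>A\<in>P. card A)"
    using less.prems(1) finA unfolding partition_on_def by (metis card_Union_disjoint)
  \<comment> \<open>The number of odd parts has the parity of \<open>card E\<close>, whatever the
    partition.\<close>
  then have par: "?t P mod 2 = k mod 2"
    using assms(4) by (simp add: mod_sum_eq)
  \<comment> \<open>A merge with an even part leaves the number of odd parts unchanged, and any
    merge lowers it by at most 2; under \<open>t\<close> it stays at least \<open>k\<close>.\<close>
  have merge: ?case
    if AB: "A \<in> P" "B \<in> P" "B \<noteq> A" "vertices_of f A \<inter> vertices_of f B \<noteq> {}"
      and t: "even (card A) \<or> ?t P \<ge> k + 2" for A B
  proof -
    let ?R = "P - {A, B}"
    have dis: "A \<inter> B = {}" "A \<noteq> {}" "B \<noteq> {}"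
      using AB disjointD[OF partition_onD2[OF less.prems(1)] AB(1,2)] partition_onD3[OF less.prems(1)]
      by auto
    \<comment> \<open>The union has to be a new block, so that \<open>insert\<close> really adds one
      summand.\<close>
    have new: "A \<union> B \<notin> ?R"
    proof
      assume "A \<union> B \<in> ?R"
      then have "(A \<union> B) \<inter> A = {}"
        using disjointD[OF partition_onD2[OF less.prems(1)] _ AB(1)] by blast
      with dis(2) show False by blast
    qed
    have P: "P = insert A (insert B ?R)" using AB by auto
    have "card P = card ?R + 2"
      using finP AB by (subst P) (simp del: insert_Diff_single)
    moreover have "card (insert (A \<union> B) ?R) = card ?R + 1"
      using new finP by simp
    ultimately have smaller: "card (insert (A \<union> B) ?R) < card P" by simp
    have "?t P = card A mod 2 + card B mod 2 + ?t ?R"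
      using finP AB by (subst P) (simp del: insert_Diff_single)
    moreover have "?t (insert (A \<union> B) ?R) = (card A + card B) mod 2 + ?t ?R"
      using new finP finA AB dis by (simp add: card_Un_disjoint)
    ultimately have "?t (insert (A \<union> B) ?R) \<ge> k"
      using t less.prems(3) by (cases "even (card A)") (auto simp: mod2_eq_if)
    moreover have "\<forall>C\<in>insert (A \<union> B) ?R. eulerian_edge_set f C"
      using less.prems(2) eulerian_edge_set_Un[OF _ _ finA finA dis(1) AB(4)] AB(1,2) by blast
    ultimately show ?thesis
      using less.hyps[OF smaller merge_partition[OF less.prems(1)]] AB by blast
  qed
  show ?case
  proof (cases "\<exists>A\<in>P. even (card A)")
    case True
    then obtain A where A: "A \<in> P" "even (card A)" by blast
    \<comment> \<open>A single even part would make the number of odd parts 0, below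
      \<open>k\<close>.\<close>
    then have "P \<noteq> {A}" using less.prems(3) assms(3) by auto
    with A show ?thesis
      using exists_touching_part[OF less.prems(1) assms(2)] merge by metis
  next
    case False
    then have t: "?t P = card P" by (simp add: odd_iff_mod_2_eq_one)
    show ?thesis
    proof (cases "card P = k")
      case True
      then show ?thesis using False less.prems by blast
    next
      case neq: False
      \<comment> \<open>The number of odd parts is at least \<open>k\<close>, differs from
        \<open>k\<close> and has the same parity.\<close>
      then have big: "?t P \<ge> k + 2" using t par less.prems(3) by presburger
      then obtain A where A: "A \<in> P" using t by fastforce
      moreover have "P \<noteq> {A}" using t big by auto
      ultimately show ?thesis
        using exists_touching_part[OF less.prems(1) assms(2)] merge big by metis
    qed
  qed
qed

section \<open>Odd decompositions and edge-disjoint odd circuits\<close>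

theorem theorem3p1:
  fixes G :: "('v, 'e) mgraph" and k :: nat
  assumes "finite_mgraph G" and "eulerian G"
    and "k > 0" and "k mod 2 = card (edges G) mod 2"
  shows "(\<exists>D. odd_decomposition k G D) \<longleftrightarrow>
    (\<exists>\<C>. finite \<C> \<and> card \<C> \<ge> k \<and>
      (\<forall>(vs, es)\<in>\<C>. circuit G vs es \<and> odd (length es)) \<and>
      pairwise (\<lambda>(_, es) (_, es'). disjnt (set es) (set es')) \<C>)"
proof
  assume "\<exists>D. odd_decomposition k G D"
  then obtain D where D: "decomposition G D" "finite D" "card D = k"
    "\<forall>H\<in>D. eulerian H \<and> odd (card (edges H))"
    by (auto simp: odd_decomposition_def)
  \<comment> \<open>Every part has even degrees and oddly many edges, hence contains an odd circuit.
    Disjointness of the parts passes to the chosen circuits.\<close>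
  have "\<exists>vs es. circuit G vs es \<and> set es \<subseteq> edges H \<and> odd (length es)" if "H \<in> D" for H
  proof -
    have H: "finite_mgraph H" "edges H \<subseteq> edges G" "\<forall>e\<in>edges H. ends H e = ends G e"
      using that D(1) by (auto simp: decomposition_def subgraph_def)
    have "even_edge_set (ends H) (edges H)"
      using eulerian_even_edge_set H(1) D(4) that by blast
    then have "even_edge_set (ends G) (edges H)"
      using H(3) unfolding even_edge_set_def by (simp cong: sum.cong incidence_cong)
    then show ?thesis
      using odd_even_edge_set_contains_odd_circuit[OF assms(1) H(2)] D(4) that by blast
  qed
  then obtain cv ce where c: "\<And>H. H \<in> D \<Longrightarrow>
      circuit G (cv H) (ce H) \<and> set (ce H) \<subseteq> edges H \<and> odd (length (ce H))"
    by metis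
  have disj: "disjnt (set (ce H)) (set (ce H'))" if "H \<in> D" "H' \<in> D" "H \<noteq> H'" for H H'
  proof -
    have "edges H \<noteq> edges H'"
      using D(1) that unfolding decomposition_def by (meson inj_onD)
    then have "edges H \<inter> edges H' = {}"
      using D(1) that unfolding decomposition_def partition_on_def disjoint_def by blast
    then show ?thesis using c that unfolding disjnt_def by blast
  qed
  let ?C = "(\<lambda>H. (cv H, ce H)) ` D"
  \<comment> \<open>Disjoint nonempty edge sets differ, so distinct parts yield distinct circuits
    and exactly \<open>k\<close> of them.\<close>
  have "inj_on (\<lambda>H. (cv H, ce H)) D"
  proof (rule inj_onI)
    fix H H'
    assume H: "H \<in> D" "H' \<in> D" "(cv H, ce H) = (cv H', ce H')"
    have "set (ce H) \<noteq> {}" using c[OF H(1)] by auto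
    then show "H = H'" using disj[OF H(1,2)] H(3) by (auto simp: disjnt_def)
  qed
  then have "card ?C = k" using D(3) by (simp add: card_image)
  moreover have "pairwise (\<lambda>(_, es) (_, es'). disjnt (set es) (set es')) ?C"
    unfolding pairwise_def using disj by auto
  moreover have "\<forall>(vs, es)\<in>?C. circuit G vs es \<and> odd (length es)" using c by auto
  ultimately show "\<exists>\<C>. finite \<C> \<and> card \<C> \<ge> k \<and>
      (\<forall>(vs, es)\<in>\<C>. circuit G vs es \<and> odd (length es)) \<and>
      pairwise (\<lambda>(_, es) (_, es'). disjnt (set es) (set es')) \<C>"
    using D(2) by (intro exI[of _ ?C]) auto
next
  assume "\<exists>\<C>. finite \<C> \<and> card \<C> \<ge> k \<and>
      (\<forall>(vs, es)\<in>\<C>. circuit G vs es \<and> odd (length es)) \<and>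
      pairwise (\<lambda>(_, es) (_, es'). disjnt (set es) (set es')) \<C>"
  then obtain \<C> where C: "finite \<C>" "card \<C> \<ge> k"
    "\<And>c. c \<in> \<C> \<Longrightarrow> circuit G (fst c) (snd c) \<and> odd (length (snd c))"
    "\<And>c d. c \<in> \<C> \<Longrightarrow> d \<in> \<C> \<Longrightarrow> c \<noteq> d \<Longrightarrow> set (snd c) \<inter> set (snd d) = {}"
    by (fastforce simp: pairwise_def disjnt_def)
  define S where "S = (\<lambda>c. set (snd c)) ` \<C>"
  define U where "U = \<Union>S"
  have circ: "c \<in> \<C> \<Longrightarrow> set (snd c) \<noteq> {} \<and> set (snd c) \<subseteq> edges G \<and> odd (card (set (snd c)))" for c
    using C(3)[of c] by (auto simp: circuit_def closed_trail_def walk_def distinct_card)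
  \<comment> \<open>No circuit is lost when only edge sets are kept: two rotations of the same
    circuit, for instance, would not be edge-disjoint.\<close>
  have "inj_on (\<lambda>c. set (snd c)) \<C>"
    by (rule inj_onI) (metis C(4) circ inf.idem)
  then have cardS: "card S \<ge> k" using C(2) by (simp add: S_def card_image)
  have finS: "finite S" using C(1) by (simp add: S_def)
  have SE: "\<forall>A\<in>S. eulerian_edge_set (ends G) A \<and> odd (card A) \<and> finite A"
    using circ C(3) circuit_eulerian_edge_set unfolding S_def by fast
  have US: "U \<subseteq> edges G" using circ by (auto simp: U_def S_def)
  have disS: "disjoint S" using C(4) unfolding S_def disjoint_def by blast
  have finE: "finite (edges G)" using assms(1) by (simp add: finite_mgraph_def)
  \<comment> \<open>The given circuits together form an even set, so deleting them from
    \<open>G\<close> leaves an even set that splits into eulerian parts as well.\<close>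
  have "even_edge_set (ends G) (\<Union>S)"
    using finS SE disS
  proof (induction S rule: finite_induct)
    case (insert A S)
    have "\<forall>B\<in>S. disjnt A B" "disjoint S"
      using insert.prems(2) insert.hyps(2) by (auto simp: pairwise_insert)
    then have "A \<inter> \<Union>S = {}" "even_edge_set (ends G) (\<Union>S)"
      using insert.IH insert.prems(1) by (simp_all flip: disjnt_def)
    then show ?case
      using insert.hyps(1) insert.prems(1) even_edge_set_Un[of "ends G" A "\<Union>S"]
      by (simp add: eulerian_edge_set_def)
  qed (simp add: even_edge_set_def)
  then have "even_edge_set (ends G) (edges G - U)"
    using even_edge_set_Diff[OF eulerian_even_edge_set[OF assms(1,2)]] US finE by (simp add: U_def)
  then obtain P where P: "partition_on (edges G - U) P" "\<forall>A\<in>P. eulerian_edge_set (ends G) A"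
    using even_edge_set_partition[OF assms(1)] by blast
  have "partition_on U S"
    using SE disS by (auto simp: partition_on_def U_def eulerian_edge_set_def)
  then have part: "partition_on (edges G) (S \<union> P)"
    using disjoint_union[OF disS partition_onD2[OF P(1)]] P(1) US
    unfolding partition_on_def U_def by auto
  \<comment> \<open>All blocks of \<open>S\<close> are odd, so they alone supply at least
    \<open>k\<close> odd parts; the blocks of \<open>P\<close> can only add to this.\<close>
  have "card S = (\<Sum>A\<in>S. card A mod 2)"
    using SE by (simp add: odd_iff_mod_2_eq_one)
  also have "\<dots> \<le> (\<Sum>A\<in>S \<union> P. card A mod 2)"
    using finite_elements[OF finE part] by (intro sum_mono2) auto
  finally have "(\<Sum>A\<in>S \<union> P. card A mod 2) \<ge> k" using cardS by simp
  then obtain Q where Q: "partition_on (edges G) Q"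
    "\<forall>A\<in>Q. eulerian_edge_set (ends G) A \<and> odd (card A)" "card Q = k"
    using merge_to_odd_parts[OF finE eulerian_connected_edge_set[OF assms(1,2)] assms(3,4) part] SE P(2)
    by blast
  let ?D = "spanned_subgraph G ` Q"
  have sub: "A \<subseteq> edges G" if "A \<in> Q" for A using that Q(1) by (auto simp: partition_on_def)
  \<comment> \<open>A block is recovered from its spanned subgraph as the edge set, so the
    \<open>k\<close> blocks give \<open>k\<close> different subgraphs.\<close>
  have inj: "inj_on (spanned_subgraph G) Q"
    by (rule inj_onI) (metis spanned_subgraph_simps(2))
  have "decomposition G ?D"
    unfolding decomposition_def
    using Q(1) sub subgraph_spanned_subgraph[OF assms(1)]
    by (auto simp: image_image inj_on_def)
  moreover have "finite ?D" "card ?D = k"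
    using finite_elements[OF finE Q(1)] inj Q(3) by (simp_all add: card_image)
  moreover have "\<forall>H\<in>?D. eulerian H \<and> odd (card (edges H))"
    using Q(2) sub eulerian_spanned_subgraph[OF assms(1)] by auto
  ultimately show "\<exists>D. odd_decomposition k G D"
    unfolding odd_decomposition_def by blast
qed

end
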